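(* For any connected hypergraph $\mathbb H=(V,\mathcal H)$ and any admissible matching policy $\Phi$, $$\mathrm{Stab}(\mathbb H,\Phi)\subset\mathscr N_2(\mathbb H):=\left\{\mu\in\mathscr M(V):\ \mu(T)>\frac1{r(\mathbb H)}\ \text{ for every transversal } T \text{ of } \mathbb H\right\}.$$
   Context: A hypergraph $\mathbb H=(V,\mathcal H)$ consists of a finite node set $V$ and a finite set $\mathcal H$ of subsets of $V$ (hyperedges) with union $V$. All hypergraphs are assumed simple (no hyperedge is contained in another one). $\mathbb H$ is connected if the graph whose vertices are the hyperedges, with two hyperedges adjacent when they intersect, is connected. A transversal is a set $T\subset V$ with $T\cap H\ne\emptyset$ for all $H\in\mathcal H$. The rank is $r(\mathbb H)=\max_{H\in\mathcal H}|H|$. $\mathscr M(V)$ is the set of probability measures $\mu$ on $V$ with $\mu(i)>0$ for all $i$. Matching model $(\mathbb H,\Phi,\mu)$: at each time $n\ge1$ one item enters; its class $C_n\in V$ is drawn from $\mu$, i.i.d. If the buffer contains a set of items whose classes form, together with $C_n$, a hyperedge (one item per class), the policy $\Phi$ selects one such set and these items leave immediately together with the incoming item (a match is always performed whenever possible); otherwise the incoming item is stored. $W_n$ is the word over $V$ listing the classes of unmatched items after the arrival at time $n$, in order of arrival; it takes values in the set of words in which, for each hyperedge, some class of the hyperedge does not occur. $\Phi$ is admissible if the choice of the match depends solely on the queue detail (the word) upon arrival and the incoming class, and possibly on an independent uniform draw in case of a tie; then $(W_n)$ is a Markov chain. The model is stable if $(W_n)$ is positive recurrent; $\mathrm{Stab}(\mathbb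 H,\Phi)$ is the set of $\mu\in\mathscr M(V)$ for which it is stable.
   Formalization: The rank is assumed to be at least 2; this excludes only the one-node hypergraph with the single hyperedge {1}, where every item leaves at once, the model is stable, and μ(V)=1 is not greater than 1/r=1, so the claim fails. *)

theory Defs
  imports "HOL-Probability.Probability"
begin

section \<open>Hypergraphs\<close>

definition hypergraph :: "'v set \<Rightarrow> 'v set set \<Rightarrow> bool" where
  "hypergraph V E \<longleftrightarrow> finite V \<and> \<Union>E = V"

definition simple_hypergraph :: "'v set set \<Rightarrow> bool" where
  "simple_hypergraph E \<longleftrightarrow> (\<forall>A\<in>E. \<forall>B\<in>E. A \<subseteq> B \<longrightarrow> A = B)"

definition connected_hypergraph :: "'v set set \<Rightarrow> bool" where
  "connected_hypergraph E \<longleftrightarrow>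
     (\<forall>A\<in>E. \<forall>B\<in>E. (A, B) \<in> {(G, H). G \<in> E \<and> H \<in> E \<and> G \<inter> H \<noteq> {}}\<^sup>*)"

definition transversal :: "'v set \<Rightarrow> 'v set set \<Rightarrow> 'v set \<Rightarrow> bool" where
  "transversal V E T \<longleftrightarrow> T \<subseteq> V \<and> (\<forall>H\<in>E. T \<inter> H \<noteq> {})"

definition hypergraph_rank :: "'v set set \<Rightarrow> nat" where
  "hypergraph_rank E = Max (card ` E)"

definition full_support_measures :: "'v set \<Rightarrow> 'v pmf set" where
  "full_support_measures V = {\<mu>. set_pmf \<mu> = V}"


section \<open>The matching model\<close>

definition queue_words :: "'v set \<Rightarrow> 'v set set \<Rightarrow> 'v list set" where
  "queue_words V E = {w. set w \<subseteq> V \<and> (\<forall>H\<in>E. \<not> H \<subseteq> set w)}"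

text \<open>
  A possible match of an incoming item of class \<open>c\<close> is a set \<open>J\<close> of positions in the
  queue word \<open>w\<close>. Positions, rather than classes, are recorded because the policy also decides
  which of several stored items of the same class is used.
\<close>
definition possible_matches :: "'v set set \<Rightarrow> 'v list \<Rightarrow> 'v \<Rightarrow> nat set set" where
  "possible_matches E w c =
     {J. J \<subseteq> {..<length w} \<and> inj_on (\<lambda>j. w ! j) J \<and>
         c \<notin> (\<lambda>j. w ! j) ` J \<and> insert c ((\<lambda>j. w ! j) ` J) \<in> E}"

definition uniform_draw :: "real measure" where
  "uniform_draw = restrict_space lborel {0..1}"

text \<open>
  A policy maps the queue word, the incoming class and a uniform draw on \<open>[0,1]\<close> to the match
  that is performed; its value is irrelevant when no match is possible. Membership in the set of
  measurable functions into \<open>count_space (possible_matches E w c)\<close> says that the chosen match is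
  a possible one for every draw, and that it depends measurably on the draw. When only one match is
  possible, the draw has no influence.
\<close>
type_synonym 'v policy = "'v list \<Rightarrow> 'v \<Rightarrow> real \<Rightarrow> nat set"

definition admissible :: "'v set \<Rightarrow> 'v set set \<Rightarrow> 'v policy \<Rightarrow> bool" where
  "admissible V E \<Phi> \<longleftrightarrow>
     (\<forall>w\<in>queue_words V E. \<forall>c\<in>V. possible_matches E w c \<noteq> {} \<longrightarrow>
        \<Phi> w c \<in> uniform_draw \<rightarrow>\<^sub>M count_space (possible_matches E w c))"

definition queue_step :: "'v set set \<Rightarrow> 'v policy \<Rightarrow> 'v list \<Rightarrow> 'v \<times> real \<Rightarrow> 'v list" where
  "queue_step E \<Phi> w = (\<lambda>(c, u).
     if possible_matches E w c = {} then w @ [c] else nths w (- \<Phi> w c u))"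

text \<open>
  \<open>queue E \<Phi> w \<omega> n\<close> is the queue word at time \<open>n\<close> when the initial word is \<open>w\<close>; \<open>\<omega> n\<close> consists of
  the class of the item arriving at time \<open>n + 1\<close> and of the draw used for it.
\<close>
primrec queue :: "'v set set \<Rightarrow> 'v policy \<Rightarrow> 'v list \<Rightarrow> (nat \<Rightarrow> 'v \<times> real) \<Rightarrow> nat \<Rightarrow> 'v list" where
  "queue E \<Phi> w \<omega> 0 = w"
| "queue E \<Phi> w \<omega> (Suc n) = queue_step E \<Phi> (queue E \<Phi> w \<omega> n) (\<omega> n)"

text \<open>
  The law of the i.i.d. sequence of classes and draws. Restricting \<open>\<mu>\<close> to its support makes the
  sample space of a single class countable even if the type \<open>'v\<close> is not; otherwise measurability
  with respect to the product sigma-algebra could fail.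
\<close>
definition arrivals :: "'v pmf \<Rightarrow> (nat \<Rightarrow> 'v \<times> real) measure" where
  "arrivals \<mu> =
     (\<Pi>\<^sub>M n\<in>UNIV. restrict_space (measure_pmf \<mu>) (set_pmf \<mu>) \<Otimes>\<^sub>M uniform_draw)"


section \<open>Stability\<close>

text \<open>The first positive time at which a sequence is back at its initial value (infinite if none).\<close>
definition return_time :: "(nat \<Rightarrow> 's) \<Rightarrow> ennreal" where
  "return_time x = (INF n\<in>{n. 0 < n \<and> x n = x 0}. of_nat n)"

text \<open>
  \<open>X s \<omega> n\<close> is the state at time \<open>n\<close> of the Markov chain started from \<open>s\<close>. The chain is positive
  recurrent on \<open>S\<close> if every state in \<open>S\<close> has a finite mean return time (hence also an almost
  surely finite return time).
\<close>
definition positive_recurrent ::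
    "'w measure \<Rightarrow> 's set \<Rightarrow> ('s \<Rightarrow> 'w \<Rightarrow> nat \<Rightarrow> 's) \<Rightarrow> bool" where
  "positive_recurrent P S X \<longleftrightarrow>
     (\<forall>s\<in>S. (\<integral>\<^sup>+ \<omega>. return_time (X s \<omega>) \<partial>P) < \<infinity>)"

definition Stab :: "'v set \<Rightarrow> 'v set set \<Rightarrow> 'v policy \<Rightarrow> 'v pmf set" where
  "Stab V E \<Phi> = {\<mu> \<in> full_support_measures V.
     positive_recurrent (arrivals \<mu>) (queue_words V E) (queue E \<Phi>)}"

definition N2 :: "'v set \<Rightarrow> 'v set set \<Rightarrow> 'v pmf set" where
  "N2 V E = {\<mu> \<in> full_support_measures V.
     \<forall>T. transversal V E T \<longrightarrow> measure_pmf.prob \<mu> T > 1 / real (hypergraph_rank E)}"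

end

theory Submission
  imports Defs
begin

text \<open>
  Give every class \<open>c\<close> a weight \<open>g c\<close> such that no hyperedge has positive total weight. A match
  removes the items of a hyperedge, the incoming one included, so it cannot lower the total weight
  of all items that have entered and not left. Hence the weight of the stored items dominates
  the random walk with increments \<open>g C\<^sub>n\<close> (\<open>queue_weight_ge_walk\<close>).

  Start with an empty queue and let \<open>\<tau>\<close> be the time of the first return to it. The walk is at most
  \<open>0\<close> at time \<open>\<tau>\<close>. If \<open>\<tau>\<close> has finite mean, Wald's identity shows that \<open>g\<close> has nonpositive mean
  under \<open>\<mu>\<close>. Mean \<open>0\<close> is excluded by looking only at those excursions whose first item has a class
  \<open>c0\<close> with \<open>g c0 > 0\<close>: the later increments have to bring the walk from \<open>g c0\<close> down to \<open>0\<close> or below,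
  so that their sum up to time \<open>\<tau>\<close> is at most \<open>- g c0\<close>, whereas by Wald's identity this sum has
  nonnegative expectation as soon as \<open>g\<close> has nonnegative mean. Thus in a positive recurrent model
  \<open>g\<close> has negative mean (\<open>positive_recurrent_imp_negative_drift\<close>).

  For a transversal \<open>T\<close> and rank \<open>r\<close> the weight \<open>1 - r * indicator T\<close> qualifies: on a hyperedge
  \<open>H\<close> it sums to \<open>card H - r * card (T \<inter> H)\<close>, where \<open>card H \<le> r\<close> and \<open>card (T \<inter> H) \<ge> 1\<close>. Its mean is
  \<open>1 - r * \<mu>(T)\<close>, and it is positive outside \<open>T\<close>.
\<close>

section \<open>A pathwise lower bound for weighted queue contents\<close>

lemma sum_list_map_nths:
  fixes g :: "'a \<Rightarrow> 'b::comm_monoid_add"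
  shows "sum_list (map g (nths w A)) = (\<Sum>i | i < length w \<and> i \<in> A. g (w ! i))"
proof (induction w arbitrary: A rule: rev_induct)
  case Nil
  then show ?case by simp
next
  case (snoc x w)
  have split: "{i. i < length (w @ [x]) \<and> i \<in> A}
      = {i. i < length w \<and> i \<in> A} \<union> (if length w \<in> A then {length w} else {})"
    by (auto simp: less_Suc_eq)
  have "(\<Sum>i | i < length w \<and> i \<in> A. g ((w @ [x]) ! i)) = (\<Sum>i | i < length w \<and> i \<in> A. g (w ! i))"
    by (intro sum.cong) (auto simp: nth_append)
  then show ?case
    unfolding split by (subst sum.union_disjoint) (auto simp: nths_append snoc.IH)
qed

text \<open>
  The inequality is the weight of the matched hyperedge being nonpositive; without a match there is
  equality.
\<close>

lemma queue_step_weight: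
  fixes g :: "'v \<Rightarrow> real"
  assumes edges: "\<And>H. H \<in> E \<Longrightarrow> sum g H \<le> 0"
    and choice: "possible_matches E w c \<noteq> {} \<Longrightarrow> \<Phi> w c u \<in> possible_matches E w c"
  shows "sum_list (map g w) + g c \<le> sum_list (map g (queue_step E \<Phi> w (c, u)))"
proof (cases "possible_matches E w c = {}")
  case True
  then show ?thesis by (simp add: queue_step_def)
next
  case False
  define J where "J = \<Phi> w c u"
  define K where "K = (\<lambda>j. w ! j) ` J"
  have J: "J \<subseteq> {..<length w}" "inj_on (\<lambda>j. w ! j) J" "c \<notin> K" "insert c K \<in> E"
    using choice[OF False] by (auto simp: possible_matches_def J_def K_def)
  have "finite K"
    unfolding K_def using J(1) by (blast intro: finite_subset)
  have "sum g (insert c K) = g c + (\<Sum>j\<in>J. g (w ! j))"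
    using J \<open>finite K\<close> by (simp add: K_def sum.reindex)
  then have match: "g c + (\<Sum>j\<in>J. g (w ! j)) \<le> 0"
    using edges[OF J(4)] by simp
  have "sum_list (map g w) = (\<Sum>j<length w. g (w ! j))"
    by (simp add: sum_list_sum_nth atLeast0LessThan)
  also have "\<dots> = (\<Sum>j\<in>{..<length w} - J. g (w ! j)) + (\<Sum>j\<in>J. g (w ! j))"
    by (rule sum.subset_diff) (use J in auto)
  also have "{..<length w} - J = {i. i < length w \<and> i \<in> - J}"
    by auto
  finally show ?thesis
    using match False by (simp add: queue_step_def sum_list_map_nths flip: J_def)
qed

text \<open>
  If storing \<open>c\<close> completed a hyperedge, one stored position for each of its other classes
  would be a possible match.
\<close>

lemma queue_step_in_queue_words:
  assumes w: "w \<in> queue_words V E" and c: "c \<in> V"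
  shows "queue_step E \<Phi> w (c, u) \<in> queue_words V E"
proof (cases "possible_matches E w c = {}")
  case False
  then show ?thesis
    using w set_nths_subset[of w "- \<Phi> w c u"]
    by (simp add: queue_step_def queue_words_def) (meson order_trans)
next
  case True
  have "\<not> H \<subseteq> insert c (set w)" if H: "H \<in> E" for H
  proof
    assume sub: "H \<subseteq> insert c (set w)"
    have "c \<in> H"
      using w H sub by (auto simp: queue_words_def)
    have "H - {c} \<subseteq> (\<lambda>j. w ! j) ` {..<length w}"
      using sub by (auto simp: set_conv_nth)
    then obtain J where J: "J \<subseteq> {..<length w}" "inj_on (\<lambda>j. w ! j) J" "(\<lambda>j. w ! j) ` J = H - {c}"
      using subset_image_inj[THEN iffD1] by metis
    have "J \<in> possible_matches E w c"
      using J H \<open>c \<in> H\<close> by (simp add: possible_matches_def insert_absorb)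
    with True show False by simp
  qed
  then show ?thesis
    using w c True by (auto simp: queue_step_def queue_words_def)
qed

lemma queue_in_queue_words:
  assumes "w \<in> queue_words V E" "\<And>k. k < n \<Longrightarrow> fst (\<omega> k) \<in> V"
  shows "queue E \<Phi> w \<omega> n \<in> queue_words V E"
  using assms
proof (induction n)
  case (Suc n)
  then show ?case
    using queue_step_in_queue_words[of "queue E \<Phi> w \<omega> n" V E "fst (\<omega> n)" \<Phi> "snd (\<omega> n)"] by simp
qed simp

lemma queue_cong_prefix:
  "(\<And>k. k < n \<Longrightarrow> \<omega> k = \<omega>' k) \<Longrightarrow> queue E \<Phi> w \<omega> n = queue E \<Phi> w \<omega>' n"
  by (induction n) simp_all

lemma admissible_choice:
  assumes "admissible V E \<Phi>" "w \<in> queue_words V E" "c \<in> V" "u \<in> {0..1}"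
    and "possible_matches E w c \<noteq> {}"
  shows "\<Phi> w c u \<in> possible_matches E w c"
proof -
  have "\<Phi> w c \<in> uniform_draw \<rightarrow>\<^sub>M count_space (possible_matches E w c)"
    using assms by (simp add: admissible_def)
  from measurable_space[OF this, of u] assms(4) show ?thesis
    by (simp add: uniform_draw_def space_restrict_space)
qed

text \<open>
  The queue depends on the policy, but the lower bound does not: under the law of the arrivals it
  is an i.i.d. sum, up to the weight of the initial word.
\<close>

lemma queue_weight_ge_walk:
  fixes g :: "'v \<Rightarrow> real"
  assumes edges: "\<And>H. H \<in> E \<Longrightarrow> sum g H \<le> 0"
    and adm: "admissible V E \<Phi>" and w: "w \<in> queue_words V E"
    and \<omega>: "\<And>k. \<omega> k \<in> V \<times> {0..1}"
  shows "sum_list (map g w) + (\<Sum>k<n. g (fst (\<omega> k))) \<le> sum_list (map g (queue E \<Phi> w \<omega> n))"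
proof (induction n)
  case (Suc n)
  let ?q = "queue E \<Phi> w \<omega> n"
  have cu: "fst (\<omega> k) \<in> V" "snd (\<omega> k) \<in> {0..1}" for k
    using \<omega>[of k] by auto
  have "?q \<in> queue_words V E"
    using w cu by (intro queue_in_queue_words)
  then have "sum_list (map g ?q) + g (fst (\<omega> n))
      \<le> sum_list (map g (queue_step E \<Phi> ?q (fst (\<omega> n), snd (\<omega> n))))"
    by (intro queue_step_weight[OF edges] admissible_choice[OF adm _ cu])
  with Suc.IH show ?case by simp
qed simp


section \<open>The space of arrivals\<close>

lemma sequence_space_arrivals:
  "sequence_space (restrict_space (measure_pmf \<mu>) (set_pmf \<mu>) \<Otimes>\<^sub>M uniform_draw)"
proof -
  have 1: "prob_space (restrict_space (measure_pmf \<mu>) (set_pmf \<mu>))"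
    by (intro prob_space_restrict_space) (auto simp: measure_pmf.emeasure_eq_1_AE AE_measure_pmf)
  have 2: "prob_space uniform_draw"
    unfolding uniform_draw_def by (intro prob_space_restrict_space) auto
  interpret A: prob_space "restrict_space (measure_pmf \<mu>) (set_pmf \<mu>)" by (rule 1)
  interpret B: prob_space uniform_draw by (rule 2)
  interpret AB: pair_prob_space "restrict_space (measure_pmf \<mu>) (set_pmf \<mu>)" uniform_draw ..
  show ?thesis
    unfolding sequence_space_def by (intro product_prob_spaceI) unfold_locales
qed

lemma prob_space_arrivals: "prob_space (arrivals \<mu>)"
proof -
  interpret sequence_space "restrict_space (measure_pmf \<mu>) (set_pmf \<mu>) \<Otimes>\<^sub>M uniform_draw"
    by (rule sequence_space_arrivals)
  show ?thesis unfolding arrivals_def by unfold_locales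
qed

lemma space_arrivals: "\<omega> \<in> space (arrivals \<mu>) \<longleftrightarrow> (\<forall>k. \<omega> k \<in> set_pmf \<mu> \<times> {0..1})"
  by (auto simp: arrivals_def space_PiM PiE_iff space_pair_measure space_restrict_space uniform_draw_def)

lemma sets_single_arrival:
  "sets (restrict_space (measure_pmf \<mu>) (set_pmf \<mu>) \<Otimes>\<^sub>M uniform_draw)
     = sets (count_space (set_pmf \<mu>) \<Otimes>\<^sub>M uniform_draw)"
  by (intro sets_pair_measure_cong)
     (auto simp: sets_restrict_space image_def)

lemma measurable_arrival:
  "(\<lambda>\<omega>. \<omega> k) \<in> arrivals \<mu> \<rightarrow>\<^sub>M count_space (set_pmf \<mu>) \<Otimes>\<^sub>M uniform_draw"
proof -
  have "(\<lambda>\<omega>. \<omega> k) \<in> arrivals \<mu> \<rightarrow>\<^sub>M restrict_space (measure_pmf \<mu>) (set_pmf \<mu>) \<Otimes>\<^sub>M uniform_draw"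
    unfolding arrivals_def by (rule measurable_component_singleton) simp
  then show ?thesis
    by (subst (asm) measurable_cong_sets[OF refl sets_single_arrival])
qed

lemma measurable_arrival_class:
  "(\<lambda>\<omega>. h (fst (\<omega> k))) \<in> arrivals \<mu> \<rightarrow>\<^sub>M count_space UNIV"
proof -
  have "(\<lambda>\<omega>. fst (\<omega> k)) \<in> arrivals \<mu> \<rightarrow>\<^sub>M count_space (set_pmf \<mu>)"
    by (rule measurable_compose[OF measurable_arrival measurable_fst])
  then show ?thesis
    by (rule measurable_compose) simp
qed

text \<open>
  There are only countably many words over a finite alphabet, so it is enough that a step is
  measurable from each fixed word, which is what admissibility provides.
\<close>

lemma measurable_queue:
  assumes adm: "admissible (set_pmf \<mu>) E \<Phi>" and fin: "finite (set_pmf \<mu>)"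
    and w: "w \<in> queue_words (set_pmf \<mu>) E"
  shows "(\<lambda>\<omega>. queue E \<Phi> w \<omega> n) \<in> arrivals \<mu> \<rightarrow>\<^sub>M count_space (queue_words (set_pmf \<mu>) E)"
proof (induction n)
  case 0
  then show ?case using w by simp
next
  case (Suc n)
  let ?Q = "queue_words (set_pmf \<mu>) E"
  have "?Q \<subseteq> lists (set_pmf \<mu>)"
    by (auto simp: queue_words_def)
  then have Q: "countable ?Q"
    using fin by (meson countable_lists countable_finite countable_subset)
  have step: "queue_step E \<Phi> q \<in> count_space (set_pmf \<mu>) \<Otimes>\<^sub>M uniform_draw \<rightarrow>\<^sub>M count_space ?Q"
    if q: "q \<in> ?Q" for q
  proof (rule measurable_pair_measure_countable1[OF countable_finite[OF fin]])
    fix c assume c: "c \<in> set_pmf \<mu>"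
    show "(\<lambda>u. queue_step E \<Phi> q (c, u)) \<in> uniform_draw \<rightarrow>\<^sub>M count_space ?Q"
    proof (cases "possible_matches E q c = {}")
      case True
      then show ?thesis
        using queue_step_in_queue_words[OF q c, of \<Phi>] by (simp add: queue_step_def)
    next
      case False
      have "\<Phi> q c \<in> uniform_draw \<rightarrow>\<^sub>M count_space (possible_matches E q c)"
        using adm q c False by (simp add: admissible_def)
      moreover have "(\<lambda>J. nths q (- J)) \<in> count_space (possible_matches E q c) \<rightarrow>\<^sub>M count_space ?Q"
      proof -
        have "nths q (- J) \<in> ?Q" for J
          using q set_nths_subset[of q "- J"] by (simp add: queue_words_def) (meson order_trans)
        then show ?thesis by simp
      qed
      ultimately have "(\<lambda>u. nths q (- \<Phi> q c u)) \<in> uniform_draw \<rightarrow>\<^sub>M count_space ?Q"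
        by (rule measurable_compose)
      then show ?thesis
        using False by (simp add: queue_step_def)
    qed
  qed
  have "(\<lambda>\<omega>. queue_step E \<Phi> (queue E \<Phi> w \<omega> n) (\<omega> n)) \<in> arrivals \<mu> \<rightarrow>\<^sub>M count_space ?Q"
    by (rule measurable_compose_countable'[OF measurable_compose[OF measurable_arrival step] Suc.IH Q])
  then show ?case by simp
qed

text \<open>
  The independence of the past and the next arrival, in the form needed for Wald's identity. The
  sequence of arrivals has the same law as one glued at time \<open>k\<close> from two independent copies; then
  \<open>f\<close> sees only the first copy and the class at time \<open>k\<close> only the second, so that Fubini's theorem
  applies.
\<close>

lemma expectation_past_times_next:
  fixes f :: "(nat \<Rightarrow> 'v \<times> real) \<Rightarrow> real" and g :: "'v \<Rightarrow> real"
  assumes f[measurable]: "f \<in> borel_measurable (arrivals \<mu>)" and fB: "\<And>\<omega>. \<bar>f \<omega>\<bar> \<le> B"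
    and past: "\<And>\<omega> \<omega>'. (\<And>i. i < k \<Longrightarrow> \<omega> i = \<omega>' i) \<Longrightarrow> f \<omega> = f \<omega>'"
    and fin: "finite (set_pmf \<mu>)"
  shows "(\<integral>\<omega>. f \<omega> * g (fst (\<omega> k)) \<partial>arrivals \<mu>)
           = (\<integral>\<omega>. f \<omega> \<partial>arrivals \<mu>) * measure_pmf.expectation \<mu> g"
proof -
  let ?C = "restrict_space (measure_pmf \<mu>) (set_pmf \<mu>)"
  let ?A = "arrivals \<mu>"
  interpret sequence_space "?C \<Otimes>\<^sub>M uniform_draw"
    by (rule sequence_space_arrivals)
  interpret A: prob_space ?A by (rule prob_space_arrivals)
  interpret AA: pair_prob_space ?A ?A ..
  have [measurable]: "(\<lambda>\<omega>. g (fst (\<omega> j))) \<in> borel_measurable ?A" for j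
    by (rule measurable_compose[OF measurable_arrival_class]) simp
  define C where "C = (\<Sum>c\<in>set_pmf \<mu>. \<bar>g c\<bar>)"
  have C: "\<bar>g c\<bar> \<le> C" if "c \<in> set_pmf \<mu>" for c
    unfolding C_def using fin that by (intro member_le_sum) auto
  have distr: "distr (?A \<Otimes>\<^sub>M ?A) ?A (\<lambda>(x, y). comb_seq k x y) = ?A"
    unfolding arrivals_def by (rule PiM_comb_seq)
  have comb: "(\<lambda>(x, y). comb_seq k x y) \<in> ?A \<Otimes>\<^sub>M ?A \<rightarrow>\<^sub>M ?A"
    unfolding arrivals_def by (rule measurable_comb_seq)
  have "(\<integral>\<omega>. f \<omega> * g (fst (\<omega> k)) \<partial>?A)
      = (\<integral>\<omega>. f \<omega> * g (fst (\<omega> k)) \<partial>distr (?A \<Otimes>\<^sub>M ?A) ?A (\<lambda>(x, y). comb_seq k x y))"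
    by (simp only: distr)
  also have "\<dots> = (\<integral>p. f (comb_seq k (fst p) (snd p)) * g (fst (comb_seq k (fst p) (snd p) k)) \<partial>(?A \<Otimes>\<^sub>M ?A))"
    by (subst integral_distr[OF comb]) (auto simp: case_prod_beta)
  also have "\<dots> = (\<integral>p. f (fst p) * g (fst (snd p 0)) \<partial>(?A \<Otimes>\<^sub>M ?A))"
  proof (rule Bochner_Integration.integral_cong[OF refl])
    fix p
    have "f (comb_seq k (fst p) (snd p)) = f (fst p)"
      by (rule past) (simp add: comb_seq_less)
    then show "f (comb_seq k (fst p) (snd p)) * g (fst (comb_seq k (fst p) (snd p) k))
        = f (fst p) * g (fst (snd p 0))"
      by (simp add: comb_seq_def)
  qed
  also have "\<dots> = (\<integral>x. (\<integral>y. f x * g (fst (y 0)) \<partial>?A) \<partial>?A)"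
  proof -
    have "integrable (?A \<Otimes>\<^sub>M ?A) (\<lambda>p. f (fst p) * g (fst (snd p 0)))"
    proof (rule AA.P.integrable_const_bound[where B = "B * C"])
      show "AE p in ?A \<Otimes>\<^sub>M ?A. norm (f (fst p) * g (fst (snd p 0))) \<le> B * C"
      proof (rule AE_I2)
        fix p assume "p \<in> space (?A \<Otimes>\<^sub>M ?A)"
        then have "snd p 0 \<in> set_pmf \<mu> \<times> {0..1}"
          by (auto simp: space_pair_measure space_arrivals)
        then have "\<bar>g (fst (snd p 0))\<bar> \<le> C"
          by (intro C) auto
        then show "norm (f (fst p) * g (fst (snd p 0))) \<le> B * C"
          using fB[of "fst p"] by (auto simp: abs_mult intro!: mult_mono)
      qed
    qed measurable
    from AA.integral_fst'[OF this] show ?thesis by simp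
  qed
  also have "\<dots> = (\<integral>\<omega>. f \<omega> \<partial>?A) * (\<integral>y. g (fst (y 0)) \<partial>?A)"
    by simp
  also have "(\<integral>y. g (fst (y 0)) \<partial>?A) = measure_pmf.expectation \<mu> g"
  proof -
    interpret U: prob_space uniform_draw
      unfolding uniform_draw_def by (intro prob_space_restrict_space) auto
    have g: "g \<in> borel_measurable ?C"
      by (rule measurable_restrict_space1) simp
    have "(\<integral>y. g (fst (y 0)) \<partial>?A) = (\<integral>z. g (fst z) \<partial>distr ?A (?C \<Otimes>\<^sub>M uniform_draw) (\<lambda>y. y 0))"
      using g unfolding arrivals_def
      by (intro integral_distr[symmetric] measurable_component_singleton) (auto intro: measurable_compose)
    also have "distr ?A (?C \<Otimes>\<^sub>M uniform_draw) (\<lambda>y. y 0) = ?C \<Otimes>\<^sub>M uniform_draw"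
      unfolding arrivals_def by (rule PiM_component) simp
    also have "(\<integral>z. g (fst z) \<partial>(?C \<Otimes>\<^sub>M uniform_draw)) = (\<integral>c. g c \<partial>distr (?C \<Otimes>\<^sub>M uniform_draw) ?C fst)"
      by (rule integral_distr[symmetric, OF measurable_fst g])
    also have "distr (?C \<Otimes>\<^sub>M uniform_draw) ?C fst = ?C"
      by (rule U.distr_pair_fst)
    also have "(\<integral>c. g c \<partial>?C) = measure_pmf.expectation \<mu> g"
      by (subst integral_restrict_space)
         (auto intro!: integral_cong_AE simp: AE_measure_pmf_iff)
    finally show ?thesis .
  qed
  finally show ?thesis .
qed


section \<open>Excursions from the empty queue\<close>

lemma return_time_finite_cases:
  assumes "return_time x \<noteq> \<infinity>"
  obtains n where "0 < n" "x n = x 0" "\<And>k. 0 < k \<Longrightarrow> k < n \<Longrightarrow> x k \<noteq> x 0"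
    "return_time x = of_nat n"
proof -
  have ex: "\<exists>n. 0 < n \<and> x n = x 0"
  proof (rule ccontr)
    assume "\<not> ?thesis"
    then have "{n. 0 < n \<and> x n = x 0} = {}" by auto
    with assms show False by (simp only: return_time_def) simp
  qed
  define n where "n = (LEAST n. 0 < n \<and> x n = x 0)"
  have n: "0 < n" "x n = x 0"
    using LeastI_ex[OF ex] by (auto simp: n_def)
  have least: "n \<le> k" if "0 < k" "x k = x 0" for k
    unfolding n_def using that by (intro Least_le) simp
  have "return_time x = of_nat n"
    unfolding return_time_def
    by (intro antisym INF_lower INF_greatest) (use n least in auto)
  then show ?thesis
    using that[of n] n least by (meson not_le)
qed

lemma measurable_return_time:
  assumes "\<And>n. X n \<in> M \<rightarrow>\<^sub>M count_space S" and "countable S"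
  shows "(\<lambda>\<omega>. return_time (\<lambda>n. X n \<omega>)) \<in> borel_measurable M"
proof -
  have eq: "Measurable.pred M (\<lambda>\<omega>. X n \<omega> = X 0 \<omega>)" for n
    by (rule measurable_compose_countable'[OF _ assms(1)[of 0] assms(2)])
       (rule measurable_compose[OF assms(1)], simp)
  have "return_time (\<lambda>n. X n \<omega>) = (INF n\<in>{0<..}. if X n \<omega> = X 0 \<omega> then of_nat n else \<infinity>)" for \<omega>
    unfolding return_time_def
  proof (intro antisym INF_greatest)
    fix n assume "n \<in> {n. 0 < n \<and> X n \<omega> = X 0 \<omega>}"
    then show "(INF n\<in>{0<..}. if X n \<omega> = X 0 \<omega> then of_nat n else \<infinity>) \<le> (of_nat n :: ennreal)"
      by (intro INF_lower2[of n]) auto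
  qed (auto intro: INF_lower)
  then show ?thesis
    using eq by (simp only:) measurable
qed

text \<open>
  Wald's identity is carried out by truncation: the sum \<open>F m\<close> below collects the increments after the
  first one, up to time \<open>m\<close> and within an excursion that starts with \<open>c0\<close>. Each of its terms has
  nonnegative expectation, because whether the excursion is still running is decided by the past.
  Dominated convergence, with a multiple of the return time as the bound, gives a nonnegative
  expectation in the limit, although the limit is at most \<open>- g c0\<close> on the excursions that start with
  \<open>c0\<close> and vanishes elsewhere.
\<close>

theorem positive_recurrent_imp_negative_drift:
  fixes g :: "'v \<Rightarrow> real"
  assumes edges: "\<And>H. H \<in> E \<Longrightarrow> sum g H \<le> 0" and "{} \<notin> E"
    and fin: "finite (set_pmf \<mu>)" and adm: "admissible (set_pmf \<mu>) E \<Phi>"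
    and rec: "positive_recurrent (arrivals \<mu>) (queue_words (set_pmf \<mu>) E) (queue E \<Phi>)"
    and c0: "c0 \<in> set_pmf \<mu>" "0 < g c0"
  shows "measure_pmf.expectation \<mu> g < 0"
proof (rule ccontr)
  let ?A = "arrivals \<mu>" and ?V = "set_pmf \<mu>"
  let ?X = "queue E \<Phi> []"
  assume "\<not> ?thesis"
  then have drift: "0 \<le> measure_pmf.expectation \<mu> g" by simp
  interpret A: prob_space ?A by (rule prob_space_arrivals)
  have empty: "[] \<in> queue_words ?V E"
    using \<open>{} \<notin> E\<close> by (auto simp: queue_words_def)
  have words: "countable (queue_words ?V E)"
    by (rule countable_subset[of _ "lists ?V"]) (auto simp: queue_words_def)
  note mX = measurable_queue[OF adm fin empty]
  have [measurable]: "Measurable.pred ?A (\<lambda>\<omega>. ?X \<omega> n \<noteq> [])" for n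
    by (rule measurable_compose[OF mX]) simp
  have [measurable]: "Measurable.pred ?A (\<lambda>\<omega>. fst (\<omega> 0) = c0)"
    by (rule measurable_arrival_class)
  have [measurable]: "(\<lambda>\<omega>. g (fst (\<omega> j))) \<in> borel_measurable ?A" for j
    by (rule measurable_compose[OF measurable_arrival_class]) simp
  define B where "B = (\<Sum>c\<in>?V. \<bar>g c\<bar>)"
  have B: "\<bar>g c\<bar> \<le> B" if "c \<in> ?V" for c
    unfolding B_def using fin that by (intro member_le_sum) auto
  have "0 \<le> B" using B[OF c0(1)] by simp

  define busy where "busy k \<omega> \<longleftrightarrow> fst (\<omega> 0) = c0 \<and> (\<forall>j\<in>{1..k}. ?X \<omega> j \<noteq> [])" for k \<omega>
  define F where "F m \<omega> = (\<Sum>k\<in>{1..<m}. of_bool (busy k \<omega>) * g (fst (\<omega> k)))" for m \<omega>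
  define \<tau> where "\<tau> \<omega> = return_time (?X \<omega>)" for \<omega>
  have [measurable]: "Measurable.pred ?A (busy k)" for k
    unfolding busy_def by measurable
  have [measurable]: "F m \<in> borel_measurable ?A" for m
    unfolding F_def by measurable
  have \<tau>_meas[measurable]: "\<tau> \<in> borel_measurable ?A"
    unfolding \<tau>_def by (rule measurable_return_time[OF mX words])

  have F_nonneg: "0 \<le> (\<integral>\<omega>. F m \<omega> \<partial>?A)" for m
  proof -
    have summand: "(\<integral>\<omega>. of_bool (busy k \<omega>) * g (fst (\<omega> k)) \<partial>?A)
        = (\<integral>\<omega>. of_bool (busy k \<omega>) \<partial>?A) * measure_pmf.expectation \<mu> g" if "k \<in> {1..<m}" for k
    proof (rule expectation_past_times_next[where B = 1, OF _ _ _ fin])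
      fix \<omega> \<omega>' :: "nat \<Rightarrow> 'v \<times> real" assume eq: "\<And>i. i < k \<Longrightarrow> \<omega> i = \<omega>' i"
      have "?X \<omega> j = ?X \<omega>' j" if "j \<in> {1..k}" for j
        using eq that by (intro queue_cong_prefix) auto
      then show "(of_bool (busy k \<omega>) :: real) = of_bool (busy k \<omega>')"
        using eq[of 0] that by (simp add: busy_def)
    qed auto
    have "integrable ?A (\<lambda>\<omega>. of_bool (busy k \<omega>) * g (fst (\<omega> k)))" for k
    proof (rule A.integrable_const_bound[where B = B])
      show "AE \<omega> in ?A. norm (of_bool (busy k \<omega>) * g (fst (\<omega> k))) \<le> B"
      proof (rule AE_I2)
        fix \<omega> assume "\<omega> \<in> space ?A"
        then have "\<omega> k \<in> ?V \<times> {0..1}" by (simp add: space_arrivals)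
        then show "norm (of_bool (busy k \<omega>) * g (fst (\<omega> k))) \<le> B"
          using B[of "fst (\<omega> k)"] \<open>0 \<le> B\<close> by auto
      qed
    qed measurable
    then have "(\<integral>\<omega>. F m \<omega> \<partial>?A) = (\<Sum>k\<in>{1..<m}. \<integral>\<omega>. of_bool (busy k \<omega>) * g (fst (\<omega> k)) \<partial>?A)"
      unfolding F_def by (intro Bochner_Integration.integral_sum)
    also have "\<dots> = (\<Sum>k\<in>{1..<m}. (\<integral>\<omega>. of_bool (busy k \<omega>) \<partial>?A) * measure_pmf.expectation \<mu> g)"
      by (intro sum.cong refl summand)
    also have "\<dots> \<ge> 0"
      by (intro sum_nonneg mult_nonneg_nonneg[OF _ drift] Bochner_Integration.integral_nonneg) auto
    finally show ?thesis .
  qed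

  have \<tau>_int: "(\<integral>\<^sup>+\<omega>. \<tau> \<omega> \<partial>?A) < \<infinity>"
    using rec empty by (simp add: positive_recurrent_def \<tau>_def)
  then have \<tau>_fin: "AE \<omega> in ?A. \<tau> \<omega> \<noteq> \<infinity>"
    by (intro nn_integral_PInf_AE) auto

  have excursion: "(\<forall>m. \<bar>F m \<omega>\<bar> \<le> B * enn2real (\<tau> \<omega>)) \<and>
      (\<exists>l. (\<lambda>m. F m \<omega>) \<longlonglongrightarrow> l \<and> l \<le> - g c0 * of_bool (fst (\<omega> 0) = c0))"
    if \<omega>: "\<omega> \<in> space ?A" and "\<tau> \<omega> \<noteq> \<infinity>" for \<omega>
  proof -
    have cu: "\<omega> k \<in> ?V \<times> {0..1}" for k using \<omega> by (simp add: space_arrivals)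
    have gB: "\<bar>g (fst (\<omega> k))\<bar> \<le> B" for k using cu[of k] by (intro B) auto
    obtain n where n: "0 < n" "?X \<omega> n = []" "\<And>k. 0 < k \<Longrightarrow> k < n \<Longrightarrow> ?X \<omega> k \<noteq> []"
        and \<tau>n: "\<tau> \<omega> = of_nat n"
      using return_time_finite_cases[of "?X \<omega>"] \<open>\<tau> \<omega> \<noteq> \<infinity>\<close> by (auto simp: \<tau>_def)
    have busy_iff: "busy k \<omega> \<longleftrightarrow> fst (\<omega> 0) = c0 \<and> k < n" if "1 \<le> k" for k
      using n that by (force simp: busy_def not_less)
    have F_eq: "F m \<omega> = of_bool (fst (\<omega> 0) = c0) * (\<Sum>k\<in>{1..<min m n}. g (fst (\<omega> k)))" for m
    proof -
      have "F m \<omega> = (\<Sum>k\<in>{1..<m}. if k < n then of_bool (fst (\<omega> 0) = c0) * g (fst (\<omega> k)) else 0)"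
        unfolding F_def by (intro sum.cong) (auto simp: busy_iff)
      also have "\<dots> = (\<Sum>k\<in>{1..<min m n}. of_bool (fst (\<omega> 0) = c0) * g (fst (\<omega> k)))"
        by (intro sum.mono_neutral_cong_right) auto
      finally show ?thesis by (simp add: sum_distrib_left)
    qed
    have "\<bar>F m \<omega>\<bar> \<le> B * enn2real (\<tau> \<omega>)" for m
    proof -
      have "\<bar>F m \<omega>\<bar> \<le> \<bar>\<Sum>k\<in>{1..<min m n}. g (fst (\<omega> k))\<bar>"
        unfolding F_eq by (simp add: abs_mult)
      also have "\<dots> \<le> (\<Sum>k\<in>{1..<min m n}. B)"
        by (rule order_trans[OF sum_abs]) (intro sum_mono gB)
      also have "\<dots> \<le> B * real n"
        using \<open>0 \<le> B\<close> by (simp add: mult.commute mult_left_mono)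
      finally show ?thesis by (simp add: \<tau>n)
    qed
    moreover have "(\<lambda>m. F m \<omega>) \<longlonglongrightarrow> F n \<omega>"
      by (rule tendsto_eventually)
         (use eventually_ge_at_top[of n] in \<open>eventually_elim, simp add: F_eq min_absorb2\<close>)
    moreover have "F n \<omega> \<le> - g c0 * of_bool (fst (\<omega> 0) = c0)"
    proof (cases "fst (\<omega> 0) = c0")
      case True
      have "(\<Sum>k<n. g (fst (\<omega> k))) \<le> 0"
        using queue_weight_ge_walk[where \<omega> = \<omega> and n = n, OF edges adm empty cu] n by simp
      \<comment> \<open>The walk is at most \<open>0\<close> at time \<open>n\<close>; splitting off its first increment leaves the limit of \<open>F\<close>.\<close>
      moreover have "(\<Sum>k<n. g (fst (\<omega> k))) = g c0 + (\<Sum>k\<in>{1..<n}. g (fst (\<omega> k)))"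
        using n(1) True by (simp add: lessThan_atLeast0 sum.atLeast_Suc_lessThan)
      ultimately show ?thesis
        using True by (simp add: F_eq)
    next
      case False
      then show ?thesis by (simp add: F_eq)
    qed
    ultimately show ?thesis by blast
  qed

  have lim: "(\<lambda>m. \<integral>\<omega>. F m \<omega> \<partial>?A) \<longlonglongrightarrow> (\<integral>\<omega>. lim (\<lambda>m. F m \<omega>) \<partial>?A)"
    and lim_int: "integrable ?A (\<lambda>\<omega>. lim (\<lambda>m. F m \<omega>))"
  proof -
    have int: "integrable ?A (\<lambda>\<omega>. B * enn2real (\<tau> \<omega>))"
    proof -
      have "(\<integral>\<^sup>+\<omega>. ennreal (enn2real (\<tau> \<omega>)) \<partial>?A) = (\<integral>\<^sup>+\<omega>. \<tau> \<omega> \<partial>?A)"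
        by (rule nn_integral_cong_AE) (use \<tau>_fin in \<open>eventually_elim, simp add: less_top\<close>)
      then have "integrable ?A (\<lambda>\<omega>. enn2real (\<tau> \<omega>))"
        using \<tau>_int by (intro integrableI_nonneg) auto
      then show ?thesis by simp
    qed
    have conv: "AE \<omega> in ?A. (\<lambda>m. F m \<omega>) \<longlonglongrightarrow> lim (\<lambda>m. F m \<omega>)"
      using \<tau>_fin AE_space
    proof eventually_elim
      case (elim \<omega>)
      then show ?case using excursion[of \<omega>] by (auto dest: limI)
    qed
    have dom: "AE \<omega> in ?A. norm (F m \<omega>) \<le> B * enn2real (\<tau> \<omega>)" for m
      using \<tau>_fin AE_space
    proof eventually_elim
      case (elim \<omega>)
      then show ?case using excursion[of \<omega>] by auto
    qed
    have meas: "(\<lambda>\<omega>. lim (\<lambda>m. F m \<omega>)) \<in> borel_measurable ?A"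
      by (rule borel_measurable_lim_metric) measurable
    show "(\<lambda>m. \<integral>\<omega>. F m \<omega> \<partial>?A) \<longlonglongrightarrow> (\<integral>\<omega>. lim (\<lambda>m. F m \<omega>) \<partial>?A)"
      and "integrable ?A (\<lambda>\<omega>. lim (\<lambda>m. F m \<omega>))"
      by (rule integral_dominated_convergence[OF meas _ int conv dom]
               integrable_dominated_convergence[OF meas _ int conv dom]; measurable)+
  qed
  have "0 \<le> (\<integral>\<omega>. lim (\<lambda>m. F m \<omega>) \<partial>?A)"
    using lim F_nonneg by (intro LIMSEQ_le_const) auto
  also have "\<dots> \<le> (\<integral>\<omega>. - g c0 * of_bool (fst (\<omega> 0) = c0) \<partial>?A)"
  proof (rule integral_mono_AE[OF lim_int])
    show "integrable ?A (\<lambda>\<omega>. - g c0 * of_bool (fst (\<omega> 0) = c0))"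
      by (rule A.integrable_const_bound[where B = "g c0"]) (use c0 in auto)
    show "AE \<omega> in ?A. lim (\<lambda>m. F m \<omega>) \<le> - g c0 * of_bool (fst (\<omega> 0) = c0)"
      using \<tau>_fin AE_space
    proof eventually_elim
      case (elim \<omega>)
      then show ?case using excursion[of \<omega>] by (auto dest: limI)
    qed
  qed
  also have "\<dots> = - g c0 * pmf \<mu> c0"
  proof -
    have "(\<integral>\<omega>. (1::real) * of_bool (fst (\<omega> 0) = c0) \<partial>?A)
        = (\<integral>\<omega>. 1 \<partial>?A) * measure_pmf.expectation \<mu> (\<lambda>c. of_bool (c = c0))"
      by (rule expectation_past_times_next[where B = 1, OF _ _ _ fin]) auto
    also have "measure_pmf.expectation \<mu> (\<lambda>c. of_bool (c = c0)) = measure_pmf.expectation \<mu> (indicator {c0})"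
      by (intro Bochner_Integration.integral_cong) auto
    finally show ?thesis
      by (simp add: pmf.rep_eq A.prob_space)
  qed
  also have "\<dots> < 0"
    using c0 by (simp add: pmf_positive)
  finally show False by simp
qed


section \<open>Stability forces heavy transversals\<close>

theorem proposition4p2:
  fixes V :: "'v set" and E :: "'v set set" and \<Phi> :: "'v policy"
  assumes "hypergraph V E"
    and "simple_hypergraph E"
    and "connected_hypergraph E"
    and "2 \<le> hypergraph_rank E"
    and "admissible V E \<Phi>"
  shows "Stab V E \<Phi> \<subseteq> N2 V E"
proof
  fix \<mu> assume "\<mu> \<in> Stab V E \<Phi>"
  then have V: "set_pmf \<mu> = V"
    and rec: "positive_recurrent (arrivals \<mu>) (queue_words V E) (queue E \<Phi>)"
    by (auto simp: Stab_def full_support_measures_def)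
  define r where "r = real (hypergraph_rank E)"
  have r: "2 \<le> r" using assms(4) by (simp add: r_def)
  have fin: "finite V" and EV: "\<And>H. H \<in> E \<Longrightarrow> H \<subseteq> V"
    using assms(1) by (auto simp: hypergraph_def)
  have finE: "finite E"
    using fin EV by (meson finite_Pow_iff finite_subset PowI subsetI)
  have "1 / r < measure_pmf.prob \<mu> T" if T: "transversal V E T" for T
  proof (rule ccontr)
    assume le: "\<not> ?thesis"
    define g where "g c = 1 - r * indicator T c" for c
    have edges: "sum g H \<le> 0" if H: "H \<in> E" for H
    proof -
      have fH: "finite H" using EV[OF H] fin by (rule finite_subset)
      have "card (T \<inter> H) \<ge> 1"
        using T H fH by (auto simp: transversal_def Suc_le_eq card_gt_0_iff)
      moreover have "card H \<le> hypergraph_rank E"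
        unfolding hypergraph_rank_def using finE H by (intro Max_ge) auto
      moreover have "sum g H = card H - r * card (T \<inter> H)"
        using fH by (simp add: g_def sum_subtractf flip: sum_distrib_left) (simp add: indicator_def Int_commute sum.If_cases Int_def)
      ultimately show ?thesis
        using r mult_left_mono[of 1 "real (card (T \<inter> H))" r] unfolding r_def by linarith
    qed
    have mean: "measure_pmf.expectation \<mu> g = 1 - r * measure_pmf.prob \<mu> T"
      unfolding g_def
      by (subst Bochner_Integration.integral_diff)
         (auto intro!: integrable_mult_right measure_pmf.integrable_const_bound[where B = 1])
    \<comment> \<open>Here rank at least \<open>2\<close> matters: it makes \<open>1 / r\<close> smaller than the mass of all of \<open>V\<close>.\<close>
    have "\<exists>c\<in>V. c \<notin> T"
    proof (rule ccontr)
      assume "\<not> ?thesis"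
      then have "measure_pmf.prob \<mu> T = 1"
        using V by (subst measure_pmf.prob_eq_1) (auto simp: AE_measure_pmf_iff)
      then show False using le r by (simp add: field_simps)
    qed
    then obtain c0 where c0: "c0 \<in> V" "c0 \<notin> T" by blast
    have "{} \<notin> E" using T by (auto simp: transversal_def)
    then have "measure_pmf.expectation \<mu> g < 0"
      using edges fin assms(5) rec c0
      by (intro positive_recurrent_imp_negative_drift[of E g \<mu> \<Phi> c0]) (auto simp: V g_def)
    then show False
      using le r by (simp add: mean field_simps)
  qed
  then show "\<mu> \<in> N2 V E"
    using V by (simp add: N2_def full_support_measures_def r_def)
qed

end
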